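(* For each $n$, let $D$ be the $1$-dimensional boundary matrix of the random Erdős--Rényi filtration $\mathrm{ER}(n)$ on $n$ vertices, and let $D'$ be the reduced matrix obtained from $D$ by matrix reduction. Then, as $n\to\infty$, $$\mathbb E[\# D']=\mathcal O(n^3\log n),$$ and the expected cost of the matrix reduction satisfies $\mathbb E[\mathrm{cost}(D)]=\mathcal O(n^6\log n)$.
   Context: **Matrix reduction.** Matrices have entries in $\mathbb Z_2$. For a non-zero column $M_i$, its pivot $low(M_i)$ is the index of the lowest row (i.e. the largest row index) with a non-zero entry. $\#M_i$ is the number of non-zero entries of column $M_i$, and $\#M=\sum_i\#M_i$. Matrix reduction of $M=(M_1,\dots,M_c)$ is the following algorithm: for $i=1,\dots,c$ in order, set $M'_i:=M_i$; while $M'_i\ne 0$ and there is $j<i$ with $low(M'_j)=low(M'_i)$, replace $M'_i$ by $M'_i+M'_j$. The output $M'=(M'_1,\dots,M'_c)$ is the reduced matrix and $\#M'$ is called the fill-in. The cost of one addition $M'_i\leftarrow M'_i+M'_j$ is $\#M'_j$, and $\mathrm{cost}(M)$ is the sum of the costs of all column additions performed. **Boundary matrix.** For a finite simplicial complex with a total order on the simplices of each dimension, the $1$-dimensional boundary matrix has rows indexed by the edges and columns indexed by the triangles, in the given orders, and entry $1$ if the edge is contained in the triangle, $0$ otherwise. **Erdős--Rényi filtration.** Fix $n$ vertices and assign to each of the $\binom n2$ possible edges an independent uniform random value in $[0,1]$ (its length; almost surely all lengths are distinct). The complex $\mathrm{ER}(n,\alpha)$ is the largest subcomplex of the full simplex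 on the $n$ vertices whose edges are exactly those of length at most $\alpha$ (the clique complex of the corresponding graph). Letting $\alpha$ range from $0$ to $1$ gives the filtration $\mathrm{ER}(n)$. The entrance time of an edge is its length, and the entrance time of a triangle is the maximum of the lengths of its three edges. Edges and triangles are each ordered by increasing entrance time, with ties between triangles broken arbitrarily. All $\binom n2$ edges and $\binom n3$ triangles occur. *)

theory Defs
  imports
    "HOL-Probability.Probability"
    "HOL-Library.Z2"
    "HOL-Library.While_Combinator"
    "HOL-Library.Landau_Symbols"
    "Jordan_Normal_Form.Column_Operations"
begin

section \<open>Matrix reduction\<close>

definition col_support :: "bit mat \<Rightarrow> nat \<Rightarrow> nat set" where
  "col_support M i = {r. r < dim_row M \<and> M $$ (r, i) \<noteq> 0}"

definition col_nnz :: "bit mat \<Rightarrow> nat \<Rightarrow> nat" where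
  "col_nnz M i = card (col_support M i)"

definition mat_nnz :: "bit mat \<Rightarrow> nat" where
  "mat_nnz M = (\<Sum>i<dim_col M. col_nnz M i)"

text \<open>Only meaningful for non-zero columns, i.e. non-empty \<open>col_support\<close>.\<close>

definition low :: "bit mat \<Rightarrow> nat \<Rightarrow> nat" where
  "low M i = Max (col_support M i)"

definition can_add :: "bit mat \<Rightarrow> nat \<Rightarrow> nat \<Rightarrow> bool" where
  "can_add M i j \<longleftrightarrow> j < i \<and> col_support M i \<noteq> {} \<and> col_support M j \<noteq> {} \<and> low M j = low M i"

text \<open>
  The state consists of the current matrix and the cost accumulated so far. When column
  \<open>i\<close> is processed, all columns left of it are already reduced and hence have distinct
  pivots, so that at most one \<open>j\<close> is available and \<open>LEAST\<close> makes no real choice.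
\<close>

definition addition_step :: "nat \<Rightarrow> bit mat \<times> nat \<Rightarrow> bit mat \<times> nat" where
  "addition_step i = (\<lambda>(M, c). let j = (LEAST j. can_add M i j) in (addcol 1 i j M, c + col_nnz M j))"

definition reduce_col :: "nat \<Rightarrow> bit mat \<times> nat \<Rightarrow> bit mat \<times> nat" where
  "reduce_col i = while (\<lambda>(M, c). \<exists>j. can_add M i j) (addition_step i)"

definition matrix_reduction :: "bit mat \<Rightarrow> bit mat \<times> nat" where
  "matrix_reduction M = fold reduce_col [0..<dim_col M] (M, 0)"

definition reduced_matrix :: "bit mat \<Rightarrow> bit mat" where
  "reduced_matrix M = fst (matrix_reduction M)"

definition reduction_cost :: "bit mat \<Rightarrow> nat" where
  "reduction_cost M = snd (matrix_reduction M)"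

text \<open>The loop terminates, so \<open>while\<close> never returns an unspecified value.\<close>

lemma reduce_col_terminates:
  assumes "i < dim_col M"
  shows "\<exists>s. while_option (\<lambda>(M, c). \<exists>j. can_add M i j) (addition_step i) (M, c) = Some s"
proof (rule measure_while_option_Some[where P = "\<lambda>(M, c). i < dim_col M"
      and f = "\<lambda>(M, c). if col_support M i = {} then 0 else Suc (low M i)"], goal_cases)
  case (1 s)
  obtain A d where s: "s = (A, d)" by force
  define j where "j = (LEAST j. can_add A i j)"
  have i: "i < dim_col A" and "\<exists>j. can_add A i j" using 1 s by auto
  then have j: "can_add A i j" unfolding j_def by (auto intro: LeastI_ex)
  then have ji: "j < i" and ne: "col_support A i \<noteq> {}" "col_support A j \<noteq> {}"
    and eq: "low A j = low A i" by (auto simp: can_add_def)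
  let ?B = "addcol 1 i j A"
  have fin: "finite (col_support X k)" for X k by (auto simp: col_support_def)
  have mem: "low A i \<in> col_support A i" "low A i \<in> col_support A j"
    using Max_in[OF fin ne(1)] Max_in[OF fin ne(2)] eq by (auto simp: low_def)
  have "r < low A i" if r: "r \<in> col_support ?B i" for r
  proof -
    have rd: "r < dim_row A" and "A $$ (r, j) + A $$ (r, i) \<noteq> 0"
      using r i ji by (auto simp: col_support_def)
    then have "r \<in> col_support A i \<or> r \<in> col_support A j"
      by (auto simp: col_support_def)
    then have "r \<le> low A i" using fin eq by (metis Max_ge low_def)
    moreover have "r \<noteq> low A i"
      using mem \<open>A $$ (r, j) + A $$ (r, i) \<noteq> 0\<close>
      by (auto simp: col_support_def)
    ultimately show ?thesis by simp
  qed
  then have "col_support ?B i \<noteq> {} \<Longrightarrow> low ?B i < low A i"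
    unfolding low_def[of ?B] using fin by simp
  then show ?case using i ne s by (auto simp: addition_step_def Let_def j_def)
next
  case 2
  then show ?case using assms by simp
qed

section \<open>The filtration and its boundary matrix\<close>

text \<open>The \<open>k\<close>-dimensional faces of the full simplex on the vertices \<open>0, \<dots>, n - 1\<close>.\<close>

definition faces :: "nat \<Rightarrow> nat \<Rightarrow> nat set set" where
  "faces n k = {s. s \<subseteq> {..<n} \<and> card s = Suc k}"

abbreviation edges :: "nat \<Rightarrow> nat set set" where
  "edges n \<equiv> faces n 1"

abbreviation triangles :: "nat \<Rightarrow> nat set set" where
  "triangles n \<equiv> faces n 2"

definition ER :: "nat \<Rightarrow> (nat set \<Rightarrow> real) \<Rightarrow> real \<Rightarrow> nat set set" where
  "ER n len \<alpha> = {s. s \<noteq> {} \<and> s \<subseteq> {..<n} \<and> (\<forall>e\<in>edges n. e \<subseteq> s \<longrightarrow> len e \<le> \<alpha>)}"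

text \<open>For an edge this is its length, for a triangle the maximum of its three edge lengths.\<close>

definition entrance_time :: "(nat set \<Rightarrow> real) \<Rightarrow> nat set \<Rightarrow> real" where
  "entrance_time len s = Max (len ` {e. e \<subseteq> s \<and> card e = 2})"

lemma entrance_time_edge:
  assumes "e \<in> edges n"
  shows "entrance_time len e = len e"
proof -
  have "finite e" using assms by (auto simp: faces_def card_ge_0_finite)
  then have "{d. d \<subseteq> e \<and> card d = 2} = {e}"
    using assms by (auto simp: faces_def dest: card_subset_eq)
  then show ?thesis by (simp add: entrance_time_def)
qed

lemma in_ER_iff_entrance_time:
  assumes "s \<in> faces n k" "k \<ge> 1"
  shows "s \<in> ER n len \<alpha> \<longleftrightarrow> entrance_time len s \<le> \<alpha>"
proof -
  have s: "s \<subseteq> {..<n}" "card s \<ge> 2" "finite s" "s \<noteq> {}"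
    using assms by (auto simp: faces_def intro: finite_subset card_ge_0_finite)
  obtain d where d: "d \<subseteq> s" "card d = 2"
    using obtain_subset_with_card_n[OF s(2)] by metis
  have E: "{e. e \<subseteq> s \<and> card e = 2} = {e \<in> edges n. e \<subseteq> s}"
    using s by (auto simp: faces_def)
  have "finite {e \<in> edges n. e \<subseteq> s}"
    using finite_subset[of _ "Pow s"] s(3) by auto
  moreover have "{e \<in> edges n. e \<subseteq> s} \<noteq> {}"
    using d E by blast
  ultimately have "entrance_time len s \<le> \<alpha> \<longleftrightarrow> (\<forall>e\<in>{e \<in> edges n. e \<subseteq> s}. len e \<le> \<alpha>)"
    unfolding entrance_time_def E
    by (subst Max_le_iff[OF finite_imageI]) (assumption, blast, blast)
  also have "\<dots> \<longleftrightarrow> s \<in> ER n len \<alpha>"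
    using s(1,4) unfolding ER_def by blast
  finally show ?thesis by simp
qed

text \<open>
  A total order on the faces in \<open>S\<close> by increasing entrance time, given as a list; faces with
  equal entrance time may appear in any order.
\<close>

definition filtration_order :: "(nat set \<Rightarrow> real) \<Rightarrow> nat set set \<Rightarrow> nat set list \<Rightarrow> bool" where
  "filtration_order len S ss \<longleftrightarrow> distinct ss \<and> set ss = S \<and> sorted (map (entrance_time len) ss)"

definition boundary_matrix :: "nat set list \<Rightarrow> nat set list \<Rightarrow> bit mat" where
  "boundary_matrix es ts =
    mat (length es) (length ts) (\<lambda>(i, j). if es ! i \<subseteq> ts ! j then 1 else 0)"

end

theory Submission
  imports Defs
begin

text \<open>
  Both bounds rest on one observation. Suppose that, for some column of the boundary matrix, no
  earlier column has an entry in the row of its pivot. Adding these earlier columns to each other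
  cannot create an entry in that row, so none of them acquires the same pivot: the column is not
  touched by the reduction and keeps its original three entries. Call its pivot fresh. Almost
  surely all lengths are distinct, and then an edge \<open>e\<close> is a fresh pivot as soon as it is the longest
  edge of some triangle, namely in the first triangle that has \<open>e\<close> as its longest edge
  (\<open>fresh_pivot_of_longest_edge\<close>).

  Every non-zero reduced column has its own pivot, and at most as many entries as there are edges
  not longer than this pivot. With \<open>m\<close> edges in total, fix a threshold \<open>p\<close>. Fresh pivots
  contribute at most \<open>3 m\<close> to the fill-in. If \<open>N\<close> edges have length at most \<open>p\<close>, then the columns
  whose pivot is one of them contribute at most \<open>N\<^sup>2\<close>. Each remaining column contributes at most
  \<open>m\<close>, but its pivot \<open>e\<close> is longer than \<open>p\<close> and not fresh, so that no other vertex is joined to both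
  ends of \<open>e\<close> by edges of length at most \<open>p\<close> (\<open>mat_nnz_reduced_boundary_le\<close>).

  By independence the last event has probability \<open>(1 - p\<^sup>2)^(n - 2)\<close>, and the expectation of \<open>N\<^sup>2\<close>
  is at most \<open>m\<^sup>2 p\<^sup>2 + m p\<close> (\<open>expectation_fill_bound\<close>). For \<open>p\<^sup>2 = ln n / n\<close> the probability
  is \<open>O(1 / n)\<close>. Since \<open>m \<le> n\<^sup>2\<close>, the short pivots then contribute \<open>O(n\<^sup>3 ln n)\<close>, the long ones
  \<open>O(n\<^sup>3)\<close> and the fresh ones \<open>O(n\<^sup>2)\<close>.

  For the cost, the pivot of the column being reduced drops with every addition. Hence each reduced
  column is added at most once to each later column, and the cost is at most the number of
  triangles times the fill-in (\<open>reduction_cost_le\<close>).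
\<close>

section \<open>Fill-in and cost of matrix reduction\<close>

lemma finite_col_support [simp, intro]: "finite (col_support M i)"
  by (simp add: col_support_def)

lemma low_in_col_support: "col_support M i \<noteq> {} \<Longrightarrow> low M i \<in> col_support M i"
  by (simp add: low_def)

lemma le_low: "r \<in> col_support M i \<Longrightarrow> r \<le> low M i"
  by (simp add: low_def)

lemma low_cong: "col_support M i = col_support N j \<Longrightarrow> low M i = low N j"
  by (simp add: low_def)

lemma col_nnz_le_Suc_low:
  "col_nnz M i \<le> Suc (low M i)"
proof -
  have "col_support M i \<subseteq> {..low M i}" using le_low by auto
  then have "card (col_support M i) \<le> card {..low M i}" by (rule card_mono[rotated]) simp
  then show ?thesis by (simp add: col_nnz_def)
qed

lemma col_support_addcol_other:
  assumes "k < dim_col A" "k \<noteq> i"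
  shows "col_support (addcol 1 i j A) k = col_support A k"
  using assms by (auto simp: col_support_def)

lemma col_support_addcol:
  assumes "i < dim_col A"
  shows "col_support (addcol 1 i j A) i
    = (col_support A i - col_support A j) \<union> (col_support A j - col_support A i)"
  using assms by (auto simp: col_support_def bit_not_zero_iff)

lemma low_addcol_less:
  assumes i: "i < dim_col A" and add: "can_add A i j"
    and r: "r \<in> col_support (addcol 1 i j A) i"
  shows "r < low A i"
proof -
  have ne: "col_support A i \<noteq> {}" "col_support A j \<noteq> {}" and eq: "low A j = low A i"
    using add by (auto simp: can_add_def)
  have "low A i \<in> col_support A i \<inter> col_support A j"
    using low_in_col_support[OF ne(1)] low_in_col_support[OF ne(2)] eq by simp
  moreover have "r \<le> low A i"
    using r le_low[of r A i] le_low[of r A j] eq by (auto simp: col_support_addcol[OF i])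
  ultimately show ?thesis
    using r unfolding col_support_addcol[OF i] by (metis DiffE IntE UnE le_neq_implies_less)
qed

text \<open>
  Each addition lowers the pivot of column \<open>i\<close> strictly, so the columns added so far are among those
  whose pivot lies above the current pivot of column \<open>i\<close>. Carrying this set through the loop shows
  that no column is added twice, which bounds the cost by the size of all columns to the left.
\<close>

lemma reduce_col_invariant:
  assumes i: "i < dim_col A" and red: "reduce_col i (A, c) = (B, d)"
  shows "dim_row B = dim_row A" "dim_col B = dim_col A"
    and "\<And>k. k < dim_col A \<Longrightarrow> k \<noteq> i \<Longrightarrow> col_support B k = col_support A k"
    and "col_support B i \<subseteq> (\<Union>j\<le>i. col_support A j)"
    and "\<nexists>j. can_add B i j"
    and "d \<le> c + (\<Sum>j<i. col_nnz A j)"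
proof -
  define used where
    "used X = {j. j < i \<and> col_support A j \<noteq> {} \<and> (col_support X i \<noteq> {} \<longrightarrow> low X i < low A j)}"
    for X
  define Inv where "Inv = (\<lambda>(X, x). dim_row X = dim_row A \<and> dim_col X = dim_col A
    \<and> (\<forall>k<dim_col A. k \<noteq> i \<longrightarrow> col_support X k = col_support A k)
    \<and> col_support X i \<subseteq> (\<Union>j\<le>i. col_support A j)
    \<and> x \<le> c + (\<Sum>j\<in>used X. col_nnz A j))"
  have fin: "finite (used X)" for X by (simp add: used_def)
  obtain s where s: "while_option (\<lambda>(M, c). \<exists>j. can_add M i j) (addition_step i) (A, c) = Some s"
    using reduce_col_terminates[OF i] by blast
  then have sB: "s = (B, d)" using red by (simp add: reduce_col_def while_def)
  have "Inv s"
  proof (rule while_option_rule[OF _ s])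
    show "Inv (A, c)" by (auto simp: Inv_def)
  next
    fix t assume "Inv t" and b: "case t of (M, c) \<Rightarrow> \<exists>j. can_add M i j"
    moreover obtain X x where t: "t = (X, x)" by force
    ultimately have dims: "dim_row X = dim_row A" "dim_col X = dim_col A"
      and other: "\<And>k. k < dim_col A \<Longrightarrow> k \<noteq> i \<Longrightarrow> col_support X k = col_support A k"
      and sub: "col_support X i \<subseteq> (\<Union>j\<le>i. col_support A j)"
      and cost: "x \<le> c + (\<Sum>j\<in>used X. col_nnz A j)"
      by (auto simp: Inv_def)
    define j where "j = (LEAST j. can_add X i j)"
    have j: "can_add X i j" unfolding j_def using b t by (auto intro: LeastI_ex)
    define Y where "Y = addcol 1 i j X"
    have step: "addition_step i t = (Y, x + col_nnz X j)"
      by (simp add: addition_step_def t Y_def j_def Let_def)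
    have ji: "j < i" and ne: "col_support X i \<noteq> {}" using j by (auto simp: can_add_def)
    have Xj: "col_support X j = col_support A j" using other[of j] ji i by simp
    have lowj: "low A j = low X i" and nej: "col_support A j \<noteq> {}"
      using j low_cong[OF Xj] Xj by (auto simp: can_add_def)
    have iX: "i < dim_col X" using i dims by simp
    have less: "low Y i < low X i" if "col_support Y i \<noteq> {}"
      using low_addcol_less[OF iX j] low_in_col_support[OF that] by (simp add: Y_def)
    \<comment> \<open>The pivot of column \<open>i\<close> drops below that of \<open>j\<close>, so \<open>j\<close> is never used again.\<close>
    have "insert j (used X) \<subseteq> used Y"
    proof
      fix k assume "k \<in> insert j (used X)"
      then have "k < i" "col_support A k \<noteq> {}" "low X i \<le> low A k"
        using ne lowj nej ji by (auto simp: used_def)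
      moreover from this have "low Y i < low A k" if "col_support Y i \<noteq> {}"
        using less[OF that] by simp
      ultimately show "k \<in> used Y" by (simp add: used_def)
    qed
    moreover have "j \<notin> used X" using lowj ne by (simp add: used_def)
    ultimately have "col_nnz A j + (\<Sum>k\<in>used X. col_nnz A k) \<le> (\<Sum>k\<in>used Y. col_nnz A k)"
      using sum_mono2[OF fin, of "insert j (used X)" Y "col_nnz A"] fin by simp
    moreover have "col_nnz X j = col_nnz A j" by (simp add: col_nnz_def Xj)
    moreover have "col_support Y i \<subseteq> (\<Union>j\<le>i. col_support A j)"
      using sub Xj ji unfolding Y_def col_support_addcol[OF iX] by fastforce
    moreover have "col_support Y k = col_support A k" if "k < dim_col A" "k \<noteq> i" for k
      using that other dims by (simp add: Y_def col_support_addcol_other)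
    ultimately show "Inv (addition_step i t)"
      using cost dims unfolding step Inv_def by (simp add: Y_def)
  qed
  moreover have "(\<Sum>j\<in>used B. col_nnz A j) \<le> (\<Sum>j<i. col_nnz A j)"
    by (rule sum_mono2) (auto simp: used_def)
  ultimately show "dim_row B = dim_row A" "dim_col B = dim_col A"
    and "\<And>k. k < dim_col A \<Longrightarrow> k \<noteq> i \<Longrightarrow> col_support B k = col_support A k"
    and "col_support B i \<subseteq> (\<Union>j\<le>i. col_support A j)"
    and "d \<le> c + (\<Sum>j<i. col_nnz A j)"
    unfolding sB Inv_def by auto
  show "\<nexists>j. can_add B i j" using while_option_stop[OF s] sB by simp
qed

lemma reduce_col_idle:
  assumes "\<nexists>j. can_add A i j"
  shows "reduce_col i (A, c) = (A, c)"
  unfolding reduce_col_def by (subst while_unfold) (use assms in auto)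

text \<open>
  The facts about the first \<open>k\<close> columns that matter later: they stay within the rows met by the
  original columns up to their own position, their pivots are distinct, and a column is left alone
  if no earlier column reaches the row of its pivot. The latter follows from the confinement to rows,
  by which no reduced earlier column can have its pivot in that row. The cost of reducing one more
  column is bounded by the fill-in of the columns before it, which are final by then.
\<close>

lemma reduce_cols_invariant:
  assumes "k \<le> dim_col M" "fold reduce_col [0..<k] (M, 0) = (A, c)"
  shows "dim_row A = dim_row M \<and> dim_col A = dim_col M
    \<and> (\<forall>j<dim_col M. k \<le> j \<longrightarrow> col_support A j = col_support M j)
    \<and> (\<forall>j<k. col_support A j \<subseteq> (\<Union>l\<le>j. col_support M l))
    \<and> (\<forall>i<k. \<forall>j<i. col_support A i \<noteq> {} \<longrightarrow> col_support A j \<noteq> {} \<longrightarrow> low A i \<noteq> low A j)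
    \<and> (\<forall>i<k. low M i \<notin> (\<Union>j<i. col_support M j) \<longrightarrow> col_support A i = col_support M i)
    \<and> c \<le> k * (\<Sum>j<k. col_nnz A j)"
  using assms
proof (induction k arbitrary: A c)
  case 0
  then show ?case by simp
next
  case (Suc k)
  obtain B b where B: "fold reduce_col [0..<k] (M, 0) = (B, b)" by force
  then have red: "reduce_col k (B, b) = (A, c)" using Suc.prems(2) by simp
  from Suc.IH[OF _ B] Suc.prems(1) have dims: "dim_row B = dim_row M" "dim_col B = dim_col M"
    and rest: "\<And>j. j < dim_col M \<Longrightarrow> k \<le> j \<Longrightarrow> col_support B j = col_support M j"
    and sub: "\<And>j. j < k \<Longrightarrow> col_support B j \<subseteq> (\<Union>l\<le>j. col_support M l)"
    and dist: "\<And>i j. i < k \<Longrightarrow> j < i \<Longrightarrow> col_support B i \<noteq> {} \<Longrightarrow> col_support B j \<noteq> {}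
      \<Longrightarrow> low B i \<noteq> low B j"
    and fresh: "\<And>i. i < k \<Longrightarrow> low M i \<notin> (\<Union>j<i. col_support M j) \<Longrightarrow> col_support B i = col_support M i"
    and cost: "b \<le> k * (\<Sum>j<k. col_nnz B j)"
    by auto
  have kB: "k < dim_col B" using Suc.prems(1) dims by simp
  note new = reduce_col_invariant[OF kB red]
  have old: "col_support A j = col_support B j" if "j < dim_col M" "j \<noteq> k" for j
    using new(3) that dims by simp
  have oldk: "col_support A j = col_support B j" "low A j = low B j" "col_nnz A j = col_nnz B j"
    if "j < k" for j
    using old[of j] that kB dims by (auto simp: low_def col_nnz_def)
  have Bk: "col_support B k = col_support M k" using rest[of k] kB dims by simp
  have "col_support A k \<subseteq> (\<Union>l\<le>k. col_support M l)"
  proof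
    fix r assume "r \<in> col_support A k"
    then obtain j where j: "j \<le> k" "r \<in> col_support B j" using new(4) by blast
    then show "r \<in> (\<Union>l\<le>k. col_support M l)"
    proof (cases "j = k")
      case False
      then show ?thesis using j sub[of j] by fastforce
    qed (use Bk in auto)
  qed
  then have sub': "\<forall>j<Suc k. col_support A j \<subseteq> (\<Union>l\<le>j. col_support M l)"
    using sub oldk by (simp add: less_Suc_eq)
  have dist': "low A i \<noteq> low A j"
    if "i < Suc k" "j < i" "col_support A i \<noteq> {}" "col_support A j \<noteq> {}" for i j
  proof (cases "i = k")
    case True
    have "\<not> can_add A k j" using new(5) by blast
    then show ?thesis using that True by (auto simp: can_add_def)
  next
    case False
    then show ?thesis using that dist[of i j] oldk[of i] oldk[of j] by simp
  qed
  have fresh': "col_support A i = col_support M i"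
    if "i < Suc k" and low: "low M i \<notin> (\<Union>j<i. col_support M j)" for i
  proof (cases "i = k")
    case True
    have "\<not> can_add B k j" for j
    proof
      assume add: "can_add B k j"
      then have jk: "j < k" and "col_support B j \<noteq> {}" "low B j = low M k"
        using low_cong[OF Bk] by (auto simp: can_add_def)
      then have "low M k \<in> col_support B j" using low_in_col_support by metis
      then show False using sub[OF jk] low True jk by fastforce
    qed
    then have "reduce_col k (B, b) = (B, b)" by (intro reduce_col_idle) blast
    then show ?thesis using red Bk True by simp
  next
    case False
    then show ?thesis using that fresh[of i] oldk[of i] by simp
  qed
  have cost': "c \<le> Suc k * (\<Sum>j<Suc k. col_nnz A j)"
  proof -
    have "c \<le> Suc k * (\<Sum>j<k. col_nnz B j)" using new(6) cost by simp
    also have "\<dots> \<le> Suc k * (\<Sum>j<Suc k. col_nnz A j)"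
      using oldk(3) by (intro mult_le_mono2) simp
    finally show ?thesis .
  qed
  have rest': "\<forall>j<dim_col M. Suc k \<le> j \<longrightarrow> col_support A j = col_support M j"
    using rest old by simp
  show ?case
    using new(1,2) dims rest' sub' dist' fresh' cost' by (intro conjI allI impI) simp_all
qed

lemma reduction_cost_le: "reduction_cost M \<le> dim_col M * mat_nnz (reduced_matrix M)"
  using reduce_cols_invariant[OF order_refl prod.collapse[symmetric], of M]
  by (simp add: reduction_cost_def reduced_matrix_def matrix_reduction_def mat_nnz_def)

text \<open>
  For a boundary matrix, row \<open>r\<close> and the witnessing column \<open>i\<close> form what is called an apparent pair in
  persistent homology: \<open>r\<close> is the last facet of \<open>i\<close>, and \<open>i\<close> is the first cofacet of \<open>r\<close>.
\<close>

definition fresh_pivot :: "bit mat \<Rightarrow> nat \<Rightarrow> bool" where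
  "fresh_pivot M r \<longleftrightarrow> (\<exists>i<dim_col M. col_support M i \<noteq> {} \<and> low M i = r
     \<and> (\<forall>j<i. r \<notin> col_support M j))"

text \<open>
  Pivots of non-zero reduced columns are distinct, so the fill-in can be counted by rows instead of
  columns. The reduced column with a fresh pivot is the unchanged column that witnesses freshness;
  any other column with pivot \<open>r\<close> is charged the trivial bound \<open>Suc r\<close>.
\<close>

lemma mat_nnz_reduced_le:
  assumes d: "\<And>i. i < dim_col M \<Longrightarrow> col_nnz M i \<le> d"
  shows "mat_nnz (reduced_matrix M) \<le> (\<Sum>r<dim_row M. if fresh_pivot M r then d else Suc r)"
proof -
  let ?R = "reduced_matrix M"
  from reduce_cols_invariant[OF order_refl prod.collapse[symmetric], of M]
  have dims: "dim_row ?R = dim_row M" "dim_col ?R = dim_col M"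
    and dist: "\<And>i j. i < dim_col M \<Longrightarrow> j < i \<Longrightarrow> col_support ?R i \<noteq> {} \<Longrightarrow> col_support ?R j \<noteq> {}
      \<Longrightarrow> low ?R i \<noteq> low ?R j"
    and fresh: "\<And>i. i < dim_col M \<Longrightarrow> low M i \<notin> (\<Union>j<i. col_support M j)
      \<Longrightarrow> col_support ?R i = col_support M i"
    by (auto simp: reduced_matrix_def matrix_reduction_def)
  define N where "N = {i. i < dim_col M \<and> col_support ?R i \<noteq> {}}"
  have inj: "inj_on (low ?R) N"
    by (rule inj_onI) (metis (mono_tags, lifting) N_def dist linorder_neqE_nat mem_Collect_eq)
  have "mat_nnz ?R = (\<Sum>i\<in>N. col_nnz ?R i)"
    unfolding mat_nnz_def dims by (rule sum.mono_neutral_right) (auto simp: N_def col_nnz_def)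
  also have "\<dots> \<le> (\<Sum>i\<in>N. if fresh_pivot M (low ?R i) then d else Suc (low ?R i))"
  proof (rule sum_mono)
    fix i assume i: "i \<in> N"
    show "col_nnz ?R i \<le> (if fresh_pivot M (low ?R i) then d else Suc (low ?R i))"
    proof (cases "fresh_pivot M (low ?R i)")
      case True
      then obtain j where j: "j < dim_col M" "col_support M j \<noteq> {}" "low M j = low ?R i"
        "\<forall>l<j. low ?R i \<notin> col_support M l" by (auto simp: fresh_pivot_def)
      then have eq: "col_support ?R j = col_support M j" by (intro fresh) auto
      then have "j \<in> N" "low ?R j = low ?R i" using j low_cong[OF eq] by (auto simp: N_def)
      then have "j = i" using inj i by (auto dest: inj_onD)
      then show ?thesis using True eq d[OF j(1)] by (simp add: col_nnz_def)
    qed (simp add: col_nnz_le_Suc_low)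
  qed
  also have "\<dots> = (\<Sum>r\<in>low ?R ` N. if fresh_pivot M r then d else Suc r)"
    by (simp add: sum.reindex[OF inj])
  also have "\<dots> \<le> (\<Sum>r<dim_row M. if fresh_pivot M r then d else Suc r)"
  proof (rule sum_mono2)
    show "low ?R ` N \<subseteq> {..<dim_row M}"
      using low_in_col_support[of ?R] dims by (fastforce simp: N_def col_support_def)
  qed auto
  finally show ?thesis .
qed

section \<open>Boundary matrices of clique filtrations\<close>

lemma finite_faces [simp, intro]: "finite (faces n k)"
  by (rule finite_subset[of _ "Pow {..<n}"]) (auto simp: faces_def)

lemma card_faces_le: "card (faces n k) \<le> n ^ Suc k"
proof (cases "Suc k \<le> n")
  case True
  then show ?thesis
    using n_subsets[of "{..<n}" "Suc k"] binomial_le_pow[of "Suc k" n]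
    by (simp only: faces_def finite_lessThan card_lessThan)
next
  case False
  have "card s \<noteq> Suc k" if "s \<subseteq> {..<n}" for s
    using card_mono[OF _ that] False by simp
  then have "faces n k = {}" by (auto simp: faces_def)
  then show ?thesis by simp
qed

lemma entrance_time_le_iff:
  assumes "t \<in> triangles n"
  shows "entrance_time len t \<le> \<alpha> \<longleftrightarrow> (\<forall>e\<in>edges n. e \<subseteq> t \<longrightarrow> len e \<le> \<alpha>)"
proof -
  have "t \<noteq> {}" "t \<subseteq> {..<n}" using assms by (auto simp: faces_def)
  then show ?thesis
    using in_ER_iff_entrance_time[OF assms, of len \<alpha>] by (simp add: ER_def)
qed

lemma edge_of_insert_cases:
  assumes "e \<in> edges n" "v \<notin> e" "d \<in> edges n" "d \<subseteq> insert v e"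
  obtains "d = e" | a where "a \<in> e" "d = {a, v}"
proof (cases "v \<in> d")
  case True
  have "card d = 2" using assms(3) by (simp add: faces_def)
  then obtain a where "d = {a, v}" "a \<noteq> v" using True by (auto simp: card_2_iff)
  then show ?thesis using that(2) assms(4) by auto
next
  case False
  then have "d \<subseteq> e" using assms(4) by auto
  moreover have "finite e" using assms(1) by (auto simp: faces_def intro: finite_subset)
  ultimately have "d = e" using assms(1,3) card_subset_eq[of e d] by (simp add: faces_def)
  then show ?thesis using that(1) by simp
qed

lemma insert_edge_triangle:
  assumes "e \<in> edges n" "v < n" "v \<notin> e"
  shows "insert v e \<in> triangles n"
proof -
  have "finite e" using assms(1) by (auto simp: faces_def intro: finite_subset)
  then show ?thesis using assms by (auto simp: faces_def)
qed

lemma filtration_order_mono: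
  assumes "filtration_order len S ss" "i \<le> j" "j < length ss"
  shows "entrance_time len (ss ! i) \<le> entrance_time len (ss ! j)"
  using assms sorted_nth_mono[of "map (entrance_time len) ss" i j]
  by (simp add: filtration_order_def)

lemma filtration_order_length:
  assumes "filtration_order len S ss"
  shows "length ss = card S"
  using assms distinct_card by (force simp: filtration_order_def)

lemma filtration_order_bij:
  assumes "filtration_order len S ss"
  shows "bij_betw (\<lambda>i. ss ! i) {..<length ss} S"
  using assms bij_betw_nth[of ss "{..<length ss}" S] by (simp add: filtration_order_def)

lemma dim_boundary_matrix [simp]:
  "dim_row (boundary_matrix es ts) = length es" "dim_col (boundary_matrix es ts) = length ts"
  by (simp_all add: boundary_matrix_def)

lemma col_support_boundary_matrix:
  assumes "i < length ts"
  shows "col_support (boundary_matrix es ts) i = {r. r < length es \<and> es ! r \<subseteq> ts ! i}"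
  using assms by (auto simp: col_support_def boundary_matrix_def split: if_splits)

text \<open>
  For an edge \<open>e\<close> longer than \<open>p\<close>, this is what can keep \<open>e\<close> from being the longest edge of a triangle.
  Comparing with the fixed \<open>p\<close> instead of the length of \<open>e\<close> leaves a condition on independent blocks of
  edges only.
\<close>

definition unfilled :: "nat \<Rightarrow> (nat set \<Rightarrow> real) \<Rightarrow> real \<Rightarrow> nat set \<Rightarrow> bool" where
  "unfilled n len p e \<longleftrightarrow> (\<forall>v\<in>{..<n} - e. \<exists>a\<in>e. p < len {a, v})"

text \<open>
  The three terms account for the fresh pivots, for the pivots of length at most \<open>p\<close>, and for the
  longer pivots that can fail to be fresh.
\<close>

definition fill_bound :: "nat \<Rightarrow> real \<Rightarrow> (nat set \<Rightarrow> real) \<Rightarrow> nat" where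
  "fill_bound n p len = 3 * card (edges n) + (card {e \<in> edges n. len e \<le> p})\<^sup>2
     + card (edges n) * card {e \<in> edges n. unfilled n len p e}"

context
  fixes n :: nat and len :: "nat set \<Rightarrow> real" and es ts :: "nat set list"
  assumes es: "filtration_order len (edges n) es"
    and ts: "filtration_order len (triangles n) ts"
begin

lemma nth_edge: "r < length es \<Longrightarrow> es ! r \<in> edges n"
  using es nth_mem by (auto simp: filtration_order_def)

lemma nth_triangle: "i < length ts \<Longrightarrow> ts ! i \<in> triangles n"
  using ts nth_mem by (auto simp: filtration_order_def)

lemma len_mono:
  assumes "r \<le> s" "s < length es"
  shows "len (es ! r) \<le> len (es ! s)"
  using filtration_order_mono[OF es assms] nth_edge[of r] nth_edge[of s] assms
  by (simp add: entrance_time_edge)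

lemma col_nnz_boundary_matrix_le:
  assumes "i < length ts"
  shows "col_nnz (boundary_matrix es ts) i \<le> 3"
proof -
  let ?S = "{r. r < length es \<and> es ! r \<subseteq> ts ! i}"
  have t: "card (ts ! i) = 3" "finite (ts ! i)"
    using nth_triangle[OF assms] by (auto simp: faces_def intro: finite_subset)
  have "inj_on (\<lambda>r. es ! r) ?S"
    using filtration_order_bij[OF es] by (auto simp: bij_betw_def inj_on_def)
  then have "card ?S \<le> card {e. e \<subseteq> ts ! i \<and> card e = 2}"
  proof (rule card_inj_on_le)
    show "(\<lambda>r. es ! r) ` ?S \<subseteq> {e. e \<subseteq> ts ! i \<and> card e = 2}"
      using nth_edge by (auto simp: faces_def)
    show "finite {e. e \<subseteq> ts ! i \<and> card e = 2}"
      by (rule finite_subset[of _ "Pow (ts ! i)"]) (auto simp: t)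
  qed
  also have "\<dots> = 3" using t by (simp add: n_subsets numeral_eq_Suc)
  finally show ?thesis by (simp add: col_nnz_def col_support_boundary_matrix[OF assms])
qed

text \<open>
  The column that witnesses freshness is the first triangle containing \<open>e\<close> that enters together
  with \<open>e\<close>; the triangle spanned by \<open>e\<close> and \<open>v\<close> shows that there is one. Earlier triangles do not contain
  \<open>e\<close>, because a triangle cannot enter before its edges. Distinct lengths are needed to conclude
  that \<open>e\<close> is the pivot: with ties, another edge of the triangle might be ordered after \<open>e\<close>.
\<close>

lemma fresh_pivot_of_longest_edge:
  assumes inj: "inj_on len (edges n)" and r: "r < length es"
    and v: "v < n" "v \<notin> es ! r"
    and less: "\<And>a. a \<in> es ! r \<Longrightarrow> len {a, v} < len (es ! r)"
  shows "fresh_pivot (boundary_matrix es ts) r"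
proof -
  let ?e = "es ! r" and ?t = "insert v (es ! r)"
  note e = nth_edge[OF r]
  have t: "?t \<in> triangles n" by (rule insert_edge_triangle[OF e v])
  have "len d \<le> len ?e" if "d \<in> edges n" "d \<subseteq> ?t" for d
    using edge_of_insert_cases[OF e v(2) that] less by (metis less_imp_le order_refl)
  then have "entrance_time len ?t \<le> len ?e" by (simp add: entrance_time_le_iff[OF t])
  moreover have len_le: "len ?e \<le> entrance_time len s" if "s \<in> triangles n" "?e \<subseteq> s" for s
    using that e entrance_time_le_iff[OF that(1), of len "entrance_time len s"] by blast
  ultimately have "entrance_time len ?t = len ?e" using t by (meson order_antisym subset_insertI)
  moreover obtain k where "k < length ts" "ts ! k = ?t"
    using t ts by (metis filtration_order_def in_set_conv_nth)
  ultimately have ex: "\<exists>k. k < length ts \<and> ?e \<subseteq> ts ! k \<and> entrance_time len (ts ! k) = len ?e"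
    by (intro exI[of _ k]) auto
  define i where "i = (LEAST k. k < length ts \<and> ?e \<subseteq> ts ! k \<and> entrance_time len (ts ! k) = len ?e)"
  have i: "i < length ts" "?e \<subseteq> ts ! i" "entrance_time len (ts ! i) = len ?e"
    using LeastI_ex[OF ex] by (auto simp: i_def)
  let ?D = "boundary_matrix es ts"
  have mem: "r \<in> col_support ?D i" using i r by (simp add: col_support_boundary_matrix)
  moreover have "s \<le> r" if "s \<in> col_support ?D i" for s
  proof (rule ccontr)
    assume "\<not> s \<le> r"
    have s: "s < length es" "es ! s \<subseteq> ts ! i"
      using that i(1) by (auto simp: col_support_boundary_matrix)
    have "len (es ! s) \<le> len ?e"
      using entrance_time_le_iff[OF nth_triangle[OF i(1)], of len "len ?e"] i(3) nth_edge[OF s(1)] s(2)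
      by simp
    moreover have "len ?e \<le> len (es ! s)" using len_mono[of r s] \<open>\<not> s \<le> r\<close> s by simp
    ultimately have "es ! s = ?e" using inj e nth_edge[OF s(1)] by (auto dest: inj_onD)
    then show False
      using es r s(1) \<open>\<not> s \<le> r\<close> nth_eq_iff_index_eq[of es s r] by (simp add: filtration_order_def)
  qed
  ultimately have "low ?D i = r" by (simp add: low_def Max_eqI)
  moreover have "r \<notin> col_support ?D j" if "j < i" for j
  proof
    assume "r \<in> col_support ?D j"
    have j: "j < length ts" using that i(1) by simp
    then have sub: "?e \<subseteq> ts ! j" using \<open>r \<in> col_support ?D j\<close> by (simp add: col_support_boundary_matrix)
    have "entrance_time len (ts ! j) \<le> len ?e"
      using filtration_order_mono[OF ts, of j i] that i by simp
    then have "entrance_time len (ts ! j) = len ?e"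
      using len_le[OF nth_triangle[OF j] sub] by simp
    then show False using not_less_Least[of j] that j sub unfolding i_def by blast
  qed
  ultimately show ?thesis using mem i(1) unfolding fresh_pivot_def by auto
qed

text \<open>
  The bound \<open>Suc r\<close> for the column with pivot in row \<open>r\<close> is replaced by the number of edges of length
  at most \<open>p\<close> when the pivot itself is that short, and by the number of all edges otherwise. A longer
  pivot that is not unfilled is the longest edge of a triangle, and is therefore fresh.
\<close>

lemma mat_nnz_reduced_boundary_le:
  assumes inj: "inj_on len (edges n)"
  shows "mat_nnz (reduced_matrix (boundary_matrix es ts)) \<le> fill_bound n p len"
proof -
  let ?D = "boundary_matrix es ts" and ?m = "card (edges n)"
  let ?short = "{e \<in> edges n. len e \<le> p}"
  \<comment> \<open>The three summands of \<open>g\<close> correspond to those of \<open>fill_bound\<close>.\<close>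
  define g where "g e = 3 + (if len e \<le> p then card ?short else 0)
    + (if unfilled n len p e then ?m else 0)" for e
  have "(if fresh_pivot ?D r then 3 else Suc r) \<le> g (es ! r)" if r: "r < length es" for r
  proof (cases "fresh_pivot ?D r")
    case True
    then show ?thesis by (simp add: g_def)
  next
    case False
    show ?thesis
    proof (cases "len (es ! r) \<le> p")
      case True
      \<comment> \<open>All rows up to \<open>r\<close> belong to edges of length at most \<open>p\<close>.\<close>
      have "inj_on (\<lambda>i. es ! i) {..r}"
        using filtration_order_bij[OF es] r by (auto simp: bij_betw_def inj_on_def)
      moreover have "(\<lambda>i. es ! i) ` {..r} \<subseteq> ?short"
        using nth_edge len_mono[OF _ r] r True by fastforce
      ultimately have "card {..r} \<le> card ?short" by (rule card_inj_on_le) simp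
      then show ?thesis using False True by (simp add: g_def)
    next
      case long: False
      have "unfilled n len p (es ! r)"
      proof (rule ccontr)
        assume "\<not> unfilled n len p (es ! r)"
        then obtain v where v: "v < n" "v \<notin> es ! r" "\<And>a. a \<in> es ! r \<Longrightarrow> len {a, v} \<le> p"
          by (force simp: unfilled_def not_less)
        then have "len {a, v} < len (es ! r)" if "a \<in> es ! r" for a
          using v(3)[OF that] long by simp
        then show False
          using fresh_pivot_of_longest_edge[OF inj r v(1,2)] \<open>\<not> fresh_pivot ?D r\<close> by blast
      qed
      moreover have "Suc r \<le> ?m" using r filtration_order_length[OF es] by simp
      ultimately show ?thesis using False by (simp add: g_def)
    qed
  qed
  then have "(\<Sum>r<dim_row ?D. if fresh_pivot ?D r then 3 else Suc r) \<le> (\<Sum>r<length es. g (es ! r))"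
    unfolding dim_boundary_matrix by (intro sum_mono) simp
  also have "\<dots> = (\<Sum>e\<in>edges n. g e)"
    by (rule sum.reindex_bij_betw[OF filtration_order_bij[OF es]])
  also have "\<dots> = 3 * ?m + (card ?short)\<^sup>2 + ?m * card {e \<in> edges n. unfilled n len p e}"
    by (simp add: g_def sum.distrib sum.If_cases Int_def power2_eq_square mult.commute)
  finally have "(\<Sum>r<dim_row ?D. if fresh_pivot ?D r then 3 else Suc r)
    \<le> 3 * ?m + (card ?short)\<^sup>2 + ?m * card {e \<in> edges n. unfilled n len p e}" .
  moreover have "mat_nnz (reduced_matrix ?D) \<le> (\<Sum>r<dim_row ?D. if fresh_pivot ?D r then 3 else Suc r)"
    by (rule mat_nnz_reduced_le) (simp add: col_nnz_boundary_matrix_le)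
  ultimately show ?thesis unfolding fill_bound_def by (rule order_trans[rotated])
qed

end

section \<open>Independent uniform variables\<close>

context prob_space
begin

text \<open>
  By independence the joint law is a product, and by Fubini the diagonal is null as soon as one of
  the two laws has no atoms.
\<close>

lemma AE_neq_of_continuous:
  fixes X Y :: "'a \<Rightarrow> real"
  assumes ind: "indep_var borel X borel Y"
    and Y: "\<And>y. emeasure (distr M borel Y) {y} = 0"
  shows "AE \<omega> in M. X \<omega> \<noteq> Y \<omega>"
proof -
  have [measurable]: "random_variable borel X" "random_variable borel Y"
    and pair: "distr M borel X \<Otimes>\<^sub>M distr M borel Y = distr M (borel \<Otimes>\<^sub>M borel) (\<lambda>\<omega>. (X \<omega>, Y \<omega>))"
    using ind by (auto simp: indep_var_distribution_eq)
  interpret Y: prob_space "distr M borel Y" by (rule prob_space_distr) simp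
  have "{z \<in> space (borel \<Otimes>\<^sub>M borel). fst z = (snd z :: real)} \<in> sets (borel \<Otimes>\<^sub>M borel)"
    by measurable
  then have D: "{z. fst z = (snd z :: real)} \<in> sets (borel \<Otimes>\<^sub>M borel)"
    by (simp add: space_pair_measure)
  have "emeasure M {\<omega> \<in> space M. X \<omega> = Y \<omega>}
    = emeasure (distr M (borel \<Otimes>\<^sub>M borel) (\<lambda>\<omega>. (X \<omega>, Y \<omega>))) {z. fst z = snd z}"
    using D by (subst emeasure_distr) (auto intro!: arg_cong[where f = "emeasure M"])
  also have "\<dots> = (\<integral>\<^sup>+x. emeasure (distr M borel Y) (Pair x -` {z. fst z = snd z}) \<partial>distr M borel X)"
    unfolding pair[symmetric] by (rule Y.emeasure_pair_measure_alt) (use D in simp)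
  also have "\<dots> = 0" using Y by (simp add: vimage_def)
  finally show ?thesis by (subst AE_iff_measurable[OF _ refl]) simp_all
qed

context
  fixes I :: "'i set" and X :: "'i \<Rightarrow> 'a \<Rightarrow> real"
  assumes ind: "indep_vars (\<lambda>_. borel) X I"
    and unif: "\<And>i. i \<in> I \<Longrightarrow> distr M borel (X i) = uniform_measure lborel {0..1}"
begin

lemma uniform_measurable: "i \<in> I \<Longrightarrow> random_variable borel (X i)"
  using ind by (simp add: indep_vars_def)

lemma uniform_pairwise_indep:
  assumes "i \<in> I" "j \<in> I" "i \<noteq> j"
  shows "indep_var borel (X i) borel (X j)"
proof -
  have "indep_var borel ((\<lambda>f. f i) \<circ> (\<lambda>\<omega>. restrict (\<lambda>k. X k \<omega>) {i}))
                  borel ((\<lambda>f. f j) \<circ> (\<lambda>\<omega>. restrict (\<lambda>k. X k \<omega>) {j}))"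
    by (rule indep_var_compose[OF indep_var_restrict[OF ind, of "{i}" "{j}"]]) (use assms in auto)
  then show ?thesis by (simp add: comp_def)
qed

lemma uniform_AE_inj:
  assumes "finite I"
  shows "AE \<omega> in M. inj_on (\<lambda>i. X i \<omega>) I"
proof -
  have "AE \<omega> in M. i \<noteq> j \<longrightarrow> X i \<omega> \<noteq> X j \<omega>" if ij: "i \<in> I" "j \<in> I" for i j
  proof (cases "i = j")
    case False
    have "emeasure lborel ({0..1} \<inter> {y}) = 0" for y :: real
      by (rule emeasure_lborel_countable) (auto intro: countable_subset[of _ "{y}"])
    then have "emeasure (distr M borel (X j)) {y} = 0" for y
      by (simp add: unif[OF ij(2)])
    then have "AE \<omega> in M. X i \<omega> \<noteq> X j \<omega>"
      by (rule AE_neq_of_continuous[OF uniform_pairwise_indep[OF ij False]])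
    then show ?thesis by simp
  qed simp
  then have "AE \<omega> in M. \<forall>i\<in>I. \<forall>j\<in>I. i \<noteq> j \<longrightarrow> X i \<omega> \<noteq> X j \<omega>"
    by (intro AE_finite_allI assms) 
  then show ?thesis by (rule AE_mp) (auto simp: inj_on_def intro!: AE_I2)
qed

lemma uniform_prob_le:
  assumes "i \<in> I" "0 \<le> p" "p \<le> 1"
  shows "prob {\<omega> \<in> space M. X i \<omega> \<le> p} = p"
proof -
  have "prob {\<omega> \<in> space M. X i \<omega> \<le> p} = measure (distr M borel (X i)) {..p}"
    using uniform_measurable[OF assms(1)]
    by (subst measure_distr) (auto intro!: arg_cong[where f = prob])
  also have "\<dots> = p"
  proof -
    have "{0..1} \<inter> {..p} = {0..p}" using assms by auto
    then show ?thesis using assms by (simp add: unif)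
  qed
  finally show ?thesis .
qed

lemma uniform_prob_all_le:
  assumes "J \<subseteq> I" "finite J" "0 \<le> p" "p \<le> 1"
  shows "prob {\<omega> \<in> space M. \<forall>j\<in>J. X j \<omega> \<le> p} = p ^ card J"
proof (cases "J = {}")
  case True
  then show ?thesis by (simp add: prob_space)
next
  case False
  have "{\<omega> \<in> space M. \<forall>j\<in>J. X j \<omega> \<le> p} = (\<Inter>j\<in>J. X j -` {..p} \<inter> space M)"
    using False by auto
  also have "prob \<dots> = (\<Prod>j\<in>J. prob (X j -` {..p} \<inter> space M))"
    by (rule indep_varsD[OF ind]) (use assms False in auto)
  also have "\<dots> = (\<Prod>j\<in>J. p)"
  proof (rule prod.cong[OF refl])
    fix j assume "j \<in> J"
    then show "prob (X j -` {..p} \<inter> space M) = p"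
      using uniform_prob_le[of j p] assms by (auto simp: vimage_def Int_def conj_commute)
  qed
  finally show ?thesis by simp
qed

lemma measurable_block:
  assumes "K \<subseteq> I" "finite K"
  shows "{\<omega> \<in> space M. \<forall>k\<in>K. X k \<omega> \<le> p} \<in> events"
proof -
  have [measurable]: "random_variable borel (X k)" if "k \<in> K" for k
    using uniform_measurable assms that by auto
  show ?thesis using assms(2) by measurable
qed

text \<open>
  For disjoint blocks \<open>K v\<close> of \<open>k\<close> variables each, the events that all variables of a block are at
  most \<open>p\<close> are independent and have probability \<open>p ^ k\<close>.
\<close>

lemma uniform_prob_no_block_le:
  assumes K: "\<And>v. v \<in> V \<Longrightarrow> K v \<subseteq> I" "\<And>v. v \<in> V \<Longrightarrow> card (K v) = k"
      "\<And>v. v \<in> V \<Longrightarrow> finite (K v)" "disjoint_family_on K V"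
    and V: "finite V" and p: "0 \<le> p" "p \<le> 1"
  shows "prob {\<omega> \<in> space M. \<forall>v\<in>V. \<exists>j\<in>K v. p < X j \<omega>} = (1 - p ^ k) ^ card V"
proof (cases "V = {}")
  case True
  then show ?thesis by (simp add: prob_space)
next
  case False
  \<comment> \<open>Restricting the variables to \<open>K v\<close> exhibits \<open>Y v\<close> as a function of the block \<open>K v\<close> only.\<close>
  define Y where "Y v \<omega> = (\<forall>j\<in>K v. restrict (\<lambda>i. X i \<omega>) (K v) j \<le> p)" for v \<omega>
  have Y: "Y v \<omega> \<longleftrightarrow> \<not> (\<exists>j\<in>K v. p < X j \<omega>)" for v \<omega>
    by (simp add: Y_def not_less)
  have indY: "indep_vars (\<lambda>_. count_space UNIV) Y V"
    unfolding Y_def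
  proof (rule indep_vars_compose2[OF indep_vars_restrict[OF ind K(1,4)]])
    fix v assume v: "v \<in> V"
    show "(\<lambda>f. \<forall>j\<in>K v. f j \<le> p) \<in> (\<Pi>\<^sub>M j\<in>K v. borel) \<rightarrow>\<^sub>M count_space UNIV"
      using K(3)[OF v] by measurable
  qed
  have "prob (\<Inter>v\<in>V. Y v -` {False} \<inter> space M) = (\<Prod>v\<in>V. prob (Y v -` {False} \<inter> space M))"
    by (rule indep_varsD_finite[OF indY False V]) simp
  moreover have "(\<Inter>v\<in>V. Y v -` {False} \<inter> space M) = {\<omega> \<in> space M. \<forall>v\<in>V. \<exists>j\<in>K v. p < X j \<omega>}"
  proof (rule Set.set_eqI)
    fix \<omega>
    obtain w where "w \<in> V" using False by blast
    then show "\<omega> \<in> (\<Inter>v\<in>V. Y v -` {False} \<inter> space M)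
      \<longleftrightarrow> \<omega> \<in> {\<omega> \<in> space M. \<forall>v\<in>V. \<exists>j\<in>K v. p < X j \<omega>}"
      unfolding INT_iff Int_iff vimage_eq mem_Collect_eq singleton_iff Y by blast
  qed
  moreover have "prob (Y v -` {False} \<inter> space M) = 1 - p ^ k" if v: "v \<in> V" for v
  proof -
    let ?A = "{\<omega> \<in> space M. \<forall>j\<in>K v. X j \<omega> \<le> p}"
    have "Y v -` {False} \<inter> space M = space M - ?A"
    proof (rule Set.set_eqI)
      fix \<omega>
      show "\<omega> \<in> Y v -` {False} \<inter> space M \<longleftrightarrow> \<omega> \<in> space M - ?A"
        unfolding Diff_iff Int_iff vimage_eq mem_Collect_eq singleton_iff Y not_less[symmetric] by blast
    qed
    also have "prob \<dots> = 1 - prob ?A"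
      by (rule prob_compl[OF measurable_block[OF K(1)[OF v] K(3)[OF v]]])
    also have "prob ?A = p ^ k"
      using uniform_prob_all_le[OF K(1)[OF v] K(3)[OF v] p] unfolding K(2)[OF v] .
    finally show ?thesis .
  qed
  ultimately show ?thesis by simp
qed

end

end

section \<open>The expected fill-in\<close>

lemma card_eq_sum_indicator:
  assumes "finite S" "\<omega> \<in> \<Omega>"
  shows "real (card {e \<in> S. Q e \<omega>}) = (\<Sum>e\<in>S. indicator {\<omega> \<in> \<Omega>. Q e \<omega>} \<omega>)"
  using assms by (simp add: indicator_def sum.If_cases Int_def)

context prob_space
begin

context
  fixes n :: nat and L :: "nat set \<Rightarrow> 'a \<Rightarrow> real" and p :: real
  assumes ind: "indep_vars (\<lambda>_. borel) L (edges n)"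
    and unif: "\<And>e. e \<in> edges n \<Longrightarrow> distr M borel (L e) = uniform_measure lborel {0..1}"
    and p: "0 \<le> p" "p \<le> 1"
begin

text \<open>
  The blocks are the pairs of edges that join an outside vertex to the two ends of \<open>e\<close>. Pairs of
  different outside vertices have no edge in common.
\<close>

lemma prob_unfilled:
  assumes e: "e \<in> edges n"
  shows "prob {\<omega> \<in> space M. unfilled n (\<lambda>e. L e \<omega>) p e} = (1 - p\<^sup>2) ^ (n - 2)"
proof -
  let ?V = "{..<n} - e"
  define K where "K v = (\<lambda>a. {a, v}) ` e" for v
  have e': "e \<subseteq> {..<n}" "card e = 2" "finite e"
    using e by (auto simp: faces_def intro: finite_subset)
  have K: "K v \<subseteq> edges n" if "v \<in> ?V" for v
  proof
    fix d assume "d \<in> K v"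
    then obtain a where "a \<in> e" "d = {a, v}" by (auto simp: K_def)
    then show "d \<in> edges n" using that e'(1) by (auto simp: faces_def card_insert_if)
  qed
  have cardK: "card (K v) = 2" for v
    unfolding K_def using e'(2) by (subst card_image) (auto simp: inj_on_def doubleton_eq_iff)
  have finK: "finite (K v)" for v by (simp add: K_def e'(3))
  have disj: "disjoint_family_on K ?V"
    unfolding disjoint_family_on_def K_def by (auto simp: doubleton_eq_iff)
  have "{\<omega> \<in> space M. unfilled n (\<lambda>e. L e \<omega>) p e}
    = {\<omega> \<in> space M. \<forall>v\<in>?V. \<exists>d\<in>K v. p < L d \<omega>}"
    by (simp add: unfilled_def K_def)
  also have "prob \<dots> = (1 - p\<^sup>2) ^ card ?V"
    by (rule uniform_prob_no_block_le[OF ind unif K cardK finK disj _ p]) simp_all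
  also have "card ?V = n - 2" using e' by (simp add: card_Diff_subset)
  finally show ?thesis .
qed

text \<open>
  The second summand is for the diagonal, where the two conditions coincide.
\<close>

lemma prob_both_short:
  assumes "e \<in> edges n" "d \<in> edges n"
  shows "prob {\<omega> \<in> space M. L e \<omega> \<le> p \<and> L d \<omega> \<le> p} \<le> p\<^sup>2 + (if e = d then p else 0)"
proof -
  have "{\<omega> \<in> space M. L e \<omega> \<le> p \<and> L d \<omega> \<le> p} = {\<omega> \<in> space M. \<forall>c\<in>{e, d}. L c \<omega> \<le> p}"
    by simp
  also have "prob \<dots> = p ^ card {e, d}"
    by (rule uniform_prob_all_le[OF ind unif _ _ p]) (use assms in auto)
  also have "\<dots> \<le> p\<^sup>2 + (if e = d then p else 0)" by (simp add: power2_eq_square)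
  finally show ?thesis .
qed

lemma measurable_edge [measurable]: "e \<in> edges n \<Longrightarrow> random_variable borel (L e)"
  by (rule uniform_measurable[OF ind unif])

lemma measurable_unfilled:
  assumes e: "e \<in> edges n"
  shows "{\<omega> \<in> space M. unfilled n (\<lambda>e. L e \<omega>) p e} \<in> events"
proof -
  have e': "e \<subseteq> {..<n}" "finite e" using e by (auto simp: faces_def intro: finite_subset)
  have "{a, v} \<in> edges n" if "v \<in> {..<n} - e" "a \<in> e" for a v
    using that e'(1) by (auto simp: faces_def card_insert_if)
  then have [measurable]: "random_variable borel (L {a, v})" if "v \<in> {..<n} - e" "a \<in> e" for a v
    using measurable_edge that by blast
  show ?thesis unfolding unfilled_def
    using e' by (intro sets.sets_Collect_finite_All sets.sets_Collect_finite_Ex) auto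
qed

text \<open>
  The squared number of short edges is the number of pairs of short edges, so both random terms are
  sums of indicators and their expectations are sums of the probabilities above.
\<close>

lemma expectation_fill_bound:
  defines "m \<equiv> real (card (edges n))"
  shows "integrable M (\<lambda>\<omega>. real (fill_bound n p (\<lambda>e. L e \<omega>)))"
    and "expectation (\<lambda>\<omega>. real (fill_bound n p (\<lambda>e. L e \<omega>)))
      \<le> 3 * m + (m\<^sup>2 * p\<^sup>2 + m * p) + m\<^sup>2 * (1 - p\<^sup>2) ^ (n - 2)"
proof -
  let ?E = "edges n"
  let ?A = "\<lambda>e d. {\<omega> \<in> space M. L e \<omega> \<le> p \<and> L d \<omega> \<le> p}"
  let ?U = "\<lambda>e. {\<omega> \<in> space M. unfilled n (\<lambda>e. L e \<omega>) p e}"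
  define G where "G \<omega> = 3 * m + (\<Sum>e\<in>?E. \<Sum>d\<in>?E. indicator (?A e d) \<omega>)
    + m * (\<Sum>e\<in>?E. indicator (?U e) \<omega>)" for \<omega>
  have A: "?A e d \<in> events" if "e \<in> ?E" "d \<in> ?E" for e d
    using that by measurable
  have eq: "real (fill_bound n p (\<lambda>e. L e \<omega>)) = G \<omega>" if \<omega>: "\<omega> \<in> space M" for \<omega>
  proof -
    have "(\<Sum>e\<in>?E. \<Sum>d\<in>?E. indicator (?A e d) \<omega> :: real)
      = (\<Sum>e\<in>?E. \<Sum>d\<in>?E. indicator {\<omega> \<in> space M. L e \<omega> \<le> p} \<omega> * indicator {\<omega> \<in> space M. L d \<omega> \<le> p} \<omega>)"
      by (intro sum.cong refl) (simp add: indicator_def)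
    also have "\<dots> = (real (card {e \<in> ?E. L e \<omega> \<le> p}))\<^sup>2"
      by (simp only: card_eq_sum_indicator[OF finite_faces \<omega>, where Q = "\<lambda>e \<omega>. L e \<omega> \<le> p"]
        power2_eq_square sum_product)
    finally show ?thesis
      by (simp add: G_def fill_bound_def m_def card_eq_sum_indicator[OF finite_faces \<omega>, 
        where Q = "\<lambda>e \<omega>. unfilled n (\<lambda>e. L e \<omega>) p e"])
  qed
  have intA: "integrable M (\<lambda>\<omega>. indicator (?A e d) \<omega> :: real)" if "e \<in> ?E" "d \<in> ?E" for e d
    using A[OF that] by (simp add: integrable_indicator_iff emeasure_eq_measure)
  have intU: "integrable M (\<lambda>\<omega>. indicator (?U e) \<omega> :: real)" if "e \<in> ?E" for e
    using measurable_unfilled[OF that] by (simp add: integrable_indicator_iff emeasure_eq_measure)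
  let ?IA = "\<lambda>\<omega>. \<Sum>e\<in>?E. \<Sum>d\<in>?E. indicator (?A e d) \<omega> :: real"
  let ?IU = "\<lambda>\<omega>. \<Sum>e\<in>?E. indicator (?U e) \<omega> :: real"
  have IA: "integrable M ?IA" by (intro Bochner_Integration.integrable_sum intA)
  have IU: "integrable M ?IU" by (intro Bochner_Integration.integrable_sum intU)
  have int: "integrable M G"
    unfolding G_def by (intro Bochner_Integration.integrable_add integrable_mult_right IA IU) simp
  then show "integrable M (\<lambda>\<omega>. real (fill_bound n p (\<lambda>e. L e \<omega>)))"
    by (subst Bochner_Integration.integrable_cong[OF refl eq])
  have "expectation (\<lambda>\<omega>. real (fill_bound n p (\<lambda>e. L e \<omega>))) = expectation G"
    by (rule Bochner_Integration.integral_cong[OF refl eq])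
  also have "expectation G = 3 * m + expectation ?IA + m * expectation ?IU"
    unfolding G_def using IA IU by (simp add: prob_space)
  also have "expectation ?IA = (\<Sum>e\<in>?E. expectation (\<lambda>\<omega>. \<Sum>d\<in>?E. indicator (?A e d) \<omega>))"
    by (intro Bochner_Integration.integral_sum Bochner_Integration.integrable_sum intA)
  also have "\<dots> = (\<Sum>e\<in>?E. \<Sum>d\<in>?E. expectation (\<lambda>\<omega>. indicator (?A e d) \<omega>))"
    by (intro sum.cong refl Bochner_Integration.integral_sum intA)
  also have "\<dots> = (\<Sum>e\<in>?E. \<Sum>d\<in>?E. prob (?A e d))"
    by (intro sum.cong refl) (simp add: Int_absorb2)
  also have "expectation ?IU = (\<Sum>e\<in>?E. expectation (\<lambda>\<omega>. indicator (?U e) \<omega>))"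
    by (intro Bochner_Integration.integral_sum intU)
  also have "\<dots> = (\<Sum>e\<in>?E. prob (?U e))"
    by (intro sum.cong refl) (simp add: Int_absorb2)
  also have "(\<Sum>e\<in>?E. prob (?U e)) = m * (1 - p\<^sup>2) ^ (n - 2)"
    by (simp add: prob_unfilled m_def)
  also have "(\<Sum>e\<in>?E. \<Sum>d\<in>?E. prob (?A e d)) \<le> (\<Sum>e\<in>?E. \<Sum>d\<in>?E. p\<^sup>2 + (if e = d then p else 0))"
    by (intro sum_mono prob_both_short)
  also have "\<dots> = m\<^sup>2 * p\<^sup>2 + m * p"
    by (simp add: sum.distrib m_def power2_eq_square algebra_simps)
  finally show "expectation (\<lambda>\<omega>. real (fill_bound n p (\<lambda>e. L e \<omega>)))
      \<le> 3 * m + (m\<^sup>2 * p\<^sup>2 + m * p) + m\<^sup>2 * (1 - p\<^sup>2) ^ (n - 2)"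
    by (simp add: power2_eq_square algebra_simps)
qed

end

end

lemma real_card_faces_le: "real (card (faces n k)) \<le> real n ^ Suc k"
  using card_faces_le[of n k] by (simp only: of_nat_le_iff flip: of_nat_power)

text \<open>
  The threshold makes \<open>m\<^sup>2 * p\<^sup>2\<close> of order \<open>n\<^sup>3 * ln n\<close>. The last term follows from
  \<open>(1 - p\<^sup>2) ^ (n - 2) \<le> exp (- p\<^sup>2 * (n - 2)) = exp (2 * ln n / n) / n\<close>. From \<open>n = 3\<close> on, \<open>ln n\<close> is at
  least \<open>1\<close>, so that the lower-order terms can be absorbed; the constant is \<open>3 + 1 + 1 + exp 2\<close>.
\<close>

lemma fill_expectation_arith:
  fixes m p :: real
  assumes n: "n \<ge> 3" and m: "0 \<le> m" "m \<le> real n ^ 2" and p: "p = sqrt (ln (real n) / real n)"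
  shows "0 \<le> p" "p \<le> 1"
    and "3 * m + (m\<^sup>2 * p\<^sup>2 + m * p) + m\<^sup>2 * (1 - p\<^sup>2) ^ (n - 2)
      \<le> (5 + exp 2) * (real n ^ 3 * ln (real n))"
proof -
  let ?x = "real n" and ?l = "ln (real n)"
  have x: "?x \<ge> 3" using n by simp
  have l1: "?l \<ge> 1" using x exp_le ln_ge_iff[of ?x 1] by linarith
  have lx: "?l \<le> ?x" using ln_le_minus_one[of ?x] x by linarith
  show p0: "0 \<le> p" using p x l1 by simp
  show p1: "p \<le> 1" using p x lx by simp
  have pp: "p\<^sup>2 = ?l / ?x" using p x l1 by simp
  have m2: "m\<^sup>2 \<le> ?x ^ 4"
    using power_mono[OF m(2) m(1), of 2] by (simp flip: power_mult)
  have x23: "?x ^ 2 \<le> ?x ^ 3 * ?l"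
  proof -
    have "?x ^ 2 * 1 \<le> ?x ^ 2 * (?x * ?l)" using x l1 mult_mono[of 1 ?x 1 ?l] by (intro mult_left_mono) auto
    then show ?thesis by (simp add: power2_eq_square power3_eq_cube mult.assoc)
  qed
  have "3 * m \<le> 3 * (?x ^ 3 * ?l)" using m(2) x23 by linarith
  moreover have "m * p \<le> ?x ^ 3 * ?l"
    using mult_left_le[of p m] m p1 x23 by linarith
  moreover have "m\<^sup>2 * p\<^sup>2 \<le> ?x ^ 3 * ?l"
  proof -
    have "m\<^sup>2 * p\<^sup>2 \<le> ?x ^ 4 * (?l / ?x)"
      unfolding pp using m2 x l1 by (intro mult_right_mono) auto
    also have "\<dots> = ?x ^ 3 * ?l" using x by (simp add: field_simps eval_nat_numeral)
    finally show ?thesis .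
  qed
  moreover have "m\<^sup>2 * (1 - p\<^sup>2) ^ (n - 2) \<le> exp 2 * (?x ^ 3 * ?l)"
  proof -
    have "(1 - p\<^sup>2) ^ (n - 2) \<le> exp (- p\<^sup>2) ^ (n - 2)"
      using p0 p1 exp_ge_add_one_self[of "- p\<^sup>2"] by (intro power_mono) (auto simp: power_le_one)
    also have "\<dots> = exp (- ?l + 2 * (?l / ?x))"
      using n x unfolding pp by (simp add: field_simps of_nat_diff flip: exp_of_nat_mult)
    also have "\<dots> = exp (2 * (?l / ?x)) / ?x"
      unfolding exp_add exp_minus using x by (simp add: divide_inverse mult.commute)
    also have "\<dots> \<le> exp 2 / ?x"
      using x lx by (intro divide_right_mono) (auto simp: divide_le_eq)
    finally have "m\<^sup>2 * (1 - p\<^sup>2) ^ (n - 2) \<le> ?x ^ 4 * (exp 2 / ?x)"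
      using m2 p0 p1 by (intro mult_mono) (auto simp: power_le_one)
    also have "\<dots> = exp 2 * ?x ^ 3" using x by (simp add: field_simps eval_nat_numeral)
    also have "\<dots> \<le> exp 2 * (?x ^ 3 * ?l)" using l1 x mult_left_mono[of 1 ?l "?x ^ 3"] by simp
    finally show ?thesis .
  qed
  ultimately show "3 * m + (m\<^sup>2 * p\<^sup>2 + m * p) + m\<^sup>2 * (1 - p\<^sup>2) ^ (n - 2)
      \<le> (5 + exp 2) * (real n ^ 3 * ln (real n))"
    by (simp add: distrib_right)
qed

section \<open>Asymptotic bounds\<close>

theorem theorem3:
  fixes P :: "nat \<Rightarrow> 'w measure"
    and len :: "nat \<Rightarrow> nat set \<Rightarrow> 'w \<Rightarrow> real"
    and es ts :: "nat \<Rightarrow> 'w \<Rightarrow> nat set list"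
  assumes "\<And>n. prob_space (P n)"
    and "\<And>n. prob_space.indep_vars (P n) (\<lambda>_. borel) (len n) (edges n)"
    and "\<And>n e. e \<in> edges n \<Longrightarrow> distr (P n) borel (len n e) = uniform_measure lborel {0..1}"
    and "\<And>n. es n \<in> P n \<rightarrow>\<^sub>M count_space UNIV"
    and "\<And>n. ts n \<in> P n \<rightarrow>\<^sub>M count_space UNIV"
    and "\<And>n \<omega>. \<omega> \<in> space (P n) \<Longrightarrow> filtration_order (\<lambda>e. len n e \<omega>) (edges n) (es n \<omega>)"
    and "\<And>n \<omega>. \<omega> \<in> space (P n) \<Longrightarrow> filtration_order (\<lambda>e. len n e \<omega>) (triangles n) (ts n \<omega>)"
  shows "(\<lambda>n. prob_space.expectation (P n)
            (\<lambda>\<omega>. real (mat_nnz (reduced_matrix (boundary_matrix (es n \<omega>) (ts n \<omega>))))))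
          \<in> O(\<lambda>n. real n ^ 3 * ln (real n))
    \<and> (\<lambda>n. prob_space.expectation (P n)
            (\<lambda>\<omega>. real (reduction_cost (boundary_matrix (es n \<omega>) (ts n \<omega>)))))
          \<in> O(\<lambda>n. real n ^ 6 * ln (real n))"
proof -
  let ?D = "\<lambda>n \<omega>. boundary_matrix (es n \<omega>) (ts n \<omega>)"
  let ?fill = "\<lambda>n \<omega>. real (mat_nnz (reduced_matrix (?D n \<omega>)))"
  let ?cost = "\<lambda>n \<omega>. real (reduction_cost (?D n \<omega>))"
  define C :: real where "C = 5 + exp 2"
  have C: "0 \<le> C" by (simp add: C_def add_nonneg_nonneg)
  have main: "prob_space.expectation (P n) (?fill n) \<le> C * (real n ^ 3 * ln (real n))
      \<and> prob_space.expectation (P n) (?cost n) \<le> C * (real n ^ 6 * ln (real n))"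
    if n: "n \<ge> 3" for n
  proof -
    interpret prob_space "P n" by (rule assms(1))
    define p where "p = sqrt (ln (real n) / real n)"
    define m where "m = real (card (edges n))"
    define F where "F \<omega> = real (fill_bound n p (\<lambda>e. len n e \<omega>))" for \<omega>
    have "m \<le> real n ^ 2" using real_card_faces_le[of n 1] by (simp only: m_def Suc_1)
    moreover have "0 \<le> m" by (simp add: m_def)
    ultimately have p: "0 \<le> p" "p \<le> 1" and bound: "3 * m + (m\<^sup>2 * p\<^sup>2 + m * p) + m\<^sup>2 * (1 - p\<^sup>2) ^ (n - 2)
      \<le> C * (real n ^ 3 * ln (real n))"
      using fill_expectation_arith[OF n _ _ p_def] unfolding C_def by blast+
    note EF = expectation_fill_bound[OF assms(2,3) p, folded m_def]
    have F0: "0 \<le> F \<omega>" for \<omega> by (simp add: F_def)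
    have F: "integrable (P n) F" using EF(1) by (simp add: F_def[abs_def])
    have EF: "expectation F \<le> C * (real n ^ 3 * ln (real n))"
      using EF(2) bound by (simp add: F_def[abs_def])
    \<comment> \<open>The combinatorial bound needs distinct lengths, hence holds only almost surely.\<close>
    have "AE \<omega> in P n. inj_on (\<lambda>e. len n e \<omega>) (edges n)"
      by (rule uniform_AE_inj[OF assms(2,3) finite_faces])
    then have fill: "AE \<omega> in P n. ?fill n \<omega> \<le> F \<omega>"
    proof (rule AE_mp, intro AE_I2 impI)
      fix \<omega> assume "\<omega> \<in> space (P n)" "inj_on (\<lambda>e. len n e \<omega>) (edges n)"
      then show "?fill n \<omega> \<le> F \<omega>"
        using mat_nnz_reduced_boundary_le[OF assms(6,7)] by (simp only: F_def of_nat_le_iff)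
    qed
    then have "expectation (?fill n) \<le> expectation F"
      using F F0 by (intro integral_mono_AE') auto
    moreover have "AE \<omega> in P n. ?cost n \<omega> \<le> real n ^ 3 * F \<omega>"
      using fill
    proof (rule AE_mp, intro AE_I2 impI)
      fix \<omega> assume \<omega>: "\<omega> \<in> space (P n)" and le: "?fill n \<omega> \<le> F \<omega>"
      have "?cost n \<omega> \<le> real (dim_col (?D n \<omega>)) * ?fill n \<omega>"
        using reduction_cost_le[of "?D n \<omega>"] by (simp only: of_nat_le_iff flip: of_nat_mult)
      also have "dim_col (?D n \<omega>) = card (triangles n)"
        using filtration_order_length[OF assms(7)[OF \<omega>]] by simp
      also have "real (card (triangles n)) * ?fill n \<omega> \<le> real n ^ 3 * F \<omega>"
        using real_card_faces_le[of n 2] le by (intro mult_mono) (simp_all add: numeral_3_eq_3)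
      finally show "?cost n \<omega> \<le> real n ^ 3 * F \<omega>" .
    qed
    then have "expectation (?cost n) \<le> expectation (\<lambda>\<omega>. real n ^ 3 * F \<omega>)"
      using F F0 by (intro integral_mono_AE') auto
    moreover have "expectation (\<lambda>\<omega>. real n ^ 3 * F \<omega>) \<le> real n ^ 3 * (C * (real n ^ 3 * ln (real n)))"
      using EF by (simp add: mult_left_mono)
    moreover have "real n ^ 3 * (C * (real n ^ 3 * ln (real n))) = C * (real n ^ 6 * ln (real n))"
      by (simp add: eval_nat_numeral)
    ultimately show ?thesis using EF by linarith
  qed
  \<comment> \<open>Expectations are non-negative, so the one-sided bounds above suffice.\<close>
  have bigo: "f \<in> O(g)" if "\<And>n. 0 \<le> f n" "\<And>n. n \<ge> 3 \<Longrightarrow> f n \<le> C * g n" for f g :: "nat \<Rightarrow> real"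
  proof (rule bigoI)
    show "\<forall>\<^sub>F n in at_top. norm (f n) \<le> C * norm (g n)"
    proof (rule eventually_sequentiallyI[of 3])
      fix n :: nat assume "3 \<le> n"
      then have "f n \<le> C * g n" by (rule that(2))
      also have "\<dots> \<le> C * norm (g n)" using C by (intro mult_left_mono) auto
      finally show "norm (f n) \<le> C * norm (g n)" using that(1)[of n] by simp
    qed
  qed
  show ?thesis using main by (intro conjI bigo) (simp_all add: integral_nonneg_AE)
qed

end
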